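(* For every fixed integer $r\ge 1$ there is a constant $C_r>0$ such that the following holds for every integer $n\ge 1$: if $A\subset 2^{[n]}$ is both an antichain and a distance-$(2r+1)$ code, then \[|A|\le C_r\, 2^n n^{-r-1/2}.\]
   Context: $[n]=\{1,\dots,n\}$ and $2^{[n]}$ is the family of all subsets of $[n]$. A family $A\subset 2^{[n]}$ is an antichain if $x\not\subset y$ for all distinct $x,y\in A$. A family $A\subset 2^{[n]}$ is a distance-$d$ code if $|x\,\triangle\, y|\ge d$ for all distinct $x,y\in A$, where $\triangle$ denotes symmetric difference. *)

theory Defs
  imports Complex_Main
begin

definition antichain :: "nat set set \<Rightarrow> bool" where
  "antichain A \<longleftrightarrow> (\<forall>x\<in>A. \<forall>y\<in>A. x \<noteq> y \<longrightarrow> \<not> x \<subseteq> y)"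

definition distance_code :: "nat \<Rightarrow> nat set set \<Rightarrow> bool" where
  "distance_code d A \<longleftrightarrow> (\<forall>x\<in>A. \<forall>y\<in>A. x \<noteq> y \<longrightarrow> card (sym_diff x y) \<ge> d)"

end

theory Submission
  imports Defs
begin

text \<open>Let \<open>D\<close> be the down-set of all sets containing no member of \<open>A\<close>, with density \<open>d\<^sub>i\<close> in layer \<open>i\<close>
  of the cube of dimension \<open>m\<close>. Adding \<open>r\<close> random elements to a random \<open>i\<close>-set leaves \<open>D\<close> with probability
  \<open>d\<^sub>i - d\<^sub>i\<^sub>+\<^sub>r\<close>. Exchanging \<open>r\<close> elements of a member of \<open>A\<close> of size \<open>i\<close> for \<open>r\<close> others produces such exits
  between layers \<open>i\<close> and \<open>i + r\<close> or between \<open>i - r\<close> and \<open>i\<close>, all of them distinct since \<open>A\<close> is a code. Hence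
  layer \<open>i\<close> contains at most \<open>M (d\<^sub>i\<^sub>-\<^sub>r - d\<^sub>i\<^sub>+\<^sub>r)\<close> members of \<open>A\<close>, where
  \<open>M = max\<^sub>i (m choose i) / (i choose r) = O(2\<^sup>m m\<^sup>-\<^sup>r\<^sup>-\<^sup>1\<^sup>/\<^sup>2)\<close>, and the sum over \<open>i\<close> telescopes to at
  most \<open>2 r M\<close>.\<close>

section \<open>Layers of a down-set and the exits from it\<close>

definition level :: "'a set set \<Rightarrow> nat \<Rightarrow> 'a set set" where
  "level D i = {z \<in> D. card z = i}"

definition density :: "'a set \<Rightarrow> 'a set set \<Rightarrow> nat \<Rightarrow> real" where
  "density V D i = real (card (level D i)) / real (card V choose i)"

text \<open>The exits, kept as pairs: the same \<open>z\<close> left by different \<open>S\<close>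
  counts several times, and the injections from exchanges rely on reading off both
  components.\<close>

definition crossings :: "'a set \<Rightarrow> 'a set set \<Rightarrow> nat \<Rightarrow> nat \<Rightarrow> ('a set \<times> 'a set) set" where
  "crossings V D r i = {(z, S). z \<in> level D i \<and> S \<subseteq> V - z \<and> card S = r \<and> z \<union> S \<notin> D}"

definition avoiding :: "'a set \<Rightarrow> 'a set set \<Rightarrow> 'a set set" where
  "avoiding V A = {z \<in> Pow V. \<forall>a\<in>A. \<not> a \<subseteq> z}"

lemma finite_level [simp]: "finite V \<Longrightarrow> D \<subseteq> Pow V \<Longrightarrow> finite (level D i)"
  unfolding level_def using finite_subset[of D "Pow V"] by auto

lemma finite_crossings:
  assumes "finite V" "D \<subseteq> Pow V"
  shows "finite (crossings V D r i)"
  by (rule finite_subset[of _ "Pow V \<times> Pow V"]) (use assms in \<open>auto simp: crossings_def level_def\<close>)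

lemma density_nonneg: "0 \<le> density V D i"
  by (simp add: density_def)

lemma density_le_1:
  assumes "finite V" "D \<subseteq> Pow V"
  shows "density V D i \<le> 1"
proof -
  have "card (level D i) \<le> card {z. z \<subseteq> V \<and> card z = i}"
    using assms by (intro card_mono) (auto simp: level_def)
  also have "\<dots> = card V choose i"
    using assms by (simp add: n_subsets)
  finally show ?thesis
    by (auto simp: density_def divide_le_eq)
qed

text \<open>Double counting: the pairs \<open>(z, S)\<close> that stay inside \<open>D\<close>
  correspond to the sets of layer \<open>i + r\<close> with a marked \<open>r\<close>-subset.
  Removing the marked subset inverts the map because \<open>D\<close> is closed under
  subsets.\<close>

lemma card_crossings:
  fixes V :: "'a set"
  assumes V: "finite V" "D \<subseteq> Pow V"
    and down: "\<And>y z. z \<in> D \<Longrightarrow> y \<subseteq> z \<Longrightarrow> y \<in> D"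
  shows "card (crossings V D r i) + card (level D (i + r)) * (i + r choose r)
       = card (level D i) * (card V - i choose r)"
proof -
  have fin: "finite z" if "z \<in> D" for z
    using that V by (meson PowD finite_subset subsetD)
  define E where "E = (SIGMA z:level D i. {S. S \<subseteq> V - z \<and> card S = r})"
  define F where "F = (SIGMA z:level D (i + r). {S. S \<subseteq> z \<and> card S = r})"
  have cardE: "card E = card (level D i) * (card V - i choose r)"
  proof -
    have "card {S. S \<subseteq> V - z \<and> card S = r} = card V - i choose r" if "z \<in> level D i" for z
      using that V fin by (subst n_subsets) (auto simp: level_def card_Diff_subset)
    then show ?thesis
      unfolding E_def using V by (subst card_SigmaI) auto
  qed
  have cardF: "card F = card (level D (i + r)) * (i + r choose r)"
  proof -
    have "card {S. S \<subseteq> z \<and> card S = r} = i + r choose r" if "z \<in> level D (i + r)" for z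
      using that fin by (subst n_subsets) (auto simp: level_def)
    moreover have "finite {S. S \<subseteq> z \<and> card S = r}" if "z \<in> level D (i + r)" for z
      using that fin by (auto simp: level_def)
    ultimately show ?thesis
      unfolding F_def using V by (subst card_SigmaI) auto
  qed
  have finE: "finite E"
    unfolding E_def using V by (intro finite_SigmaI) auto
  have bij: "bij_betw (\<lambda>(z, S). (z \<union> S, S)) (E - crossings V D r i) F"
  proof (rule bij_betw_byWitness[where f' = "\<lambda>(z, S). (z - S, S)"])
    show "(\<lambda>(z, S). (z \<union> S, S)) ` (E - crossings V D r i) \<subseteq> F"
    proof clarify
      fix z S assume "(z, S) \<in> E" "(z, S) \<notin> crossings V D r i"
      then have *: "z \<in> D" "card z = i" "S \<subseteq> V - z" "card S = r" "z \<union> S \<in> D"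
        by (auto simp: E_def crossings_def level_def)
      then have "card (z \<union> S) = i + r"
        using fin[of "z \<union> S"] by (subst card_Un_disjoint) auto
      with * show "(z \<union> S, S) \<in> F"
        by (auto simp: F_def level_def)
    qed
    show "(\<lambda>(z, S). (z - S, S)) ` F \<subseteq> E - crossings V D r i"
    proof clarify
      fix z S assume "(z, S) \<in> F"
      then have *: "z \<in> D" "card z = i + r" "S \<subseteq> z" "card S = r"
        by (auto simp: F_def level_def)
      then have "card (z - S) = i"
        using fin[of z] by (subst card_Diff_subset) (auto intro: finite_subset)
      moreover have "z - S \<in> D" "(z - S) \<union> S = z"
        using * down[of z "z - S"] by auto
      ultimately show "(z - S, S) \<in> E - crossings V D r i"
        using * V by (auto simp: E_def crossings_def level_def)
    qed
  qed (auto simp: E_def F_def crossings_def)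
  have "crossings V D r i \<subseteq> E"
    by (auto simp: E_def crossings_def)
  then have "card E = card (crossings V D r i) + card (E - crossings V D r i)"
    using finE by (metis card_Diff_subset card_mono finite_subset le_add_diff_inverse)
  with bij_betw_same_card[OF bij] cardE cardF show ?thesis
    by simp
qed

text \<open>In the whole cube the two sides of the double count agree, so normalising by that common
  number turns the count into a difference of densities.\<close>

lemma card_crossings_density:
  fixes V :: "'a set"
  assumes V: "finite V" "D \<subseteq> Pow V"
    and down: "\<And>y z. z \<in> D \<Longrightarrow> y \<subseteq> z \<Longrightarrow> y \<in> D"
    and i: "i + r \<le> card V"
  shows "real (card (crossings V D r i))
       = real (card V choose i) * real (card V - i choose r) * (density V D i - density V D (i + r))"
proof -
  have mult: "(card V choose i) * (card V - i choose r) = (card V choose (i + r)) * (i + r choose r)"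
    using choose_mult[of i "i + r" "card V"] i binomial_symmetric[of i "i + r"] by simp
  have "real (card V choose i) * real (card V - i choose r) * density V D i
      = real (card (level D i) * (card V - i choose r))"
    using i by (simp add: density_def)
  moreover have "real (card V choose i) * real (card V - i choose r) * density V D (i + r)
      = real (card (level D (i + r)) * (i + r choose r))"
    unfolding of_nat_mult[symmetric] mult using i by (simp add: density_def)
  ultimately show ?thesis
    using card_crossings[OF V down, where r = r and i = i] by (simp add: algebra_simps flip: of_nat_mult of_nat_add)
qed

section \<open>Exchanges of \<open>r\<close> elements in a code\<close>

text \<open>Two \<open>r\<close>-sets cover at most \<open>2 * r\<close> points, one short of the
  minimum distance. This is what makes both exchange maps injective.\<close>

lemma code_eqI:
  assumes "distance_code (2 * r + 1) A" "x \<in> A" "y \<in> A"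
    and "sym_diff x y \<subseteq> S \<union> T" "finite S" "finite T" "card S \<le> r" "card T \<le> r"
  shows "x = y"
proof (rule ccontr)
  assume "x \<noteq> y"
  then have "2 * r + 1 \<le> card (sym_diff x y)"
    using assms by (auto simp: distance_code_def)
  also have "\<dots> \<le> card (S \<union> T)"
    using assms by (intro card_mono) auto
  also have "\<dots> \<le> 2 * r"
    using card_Un_le[of S T] assms by linarith
  finally show False by simp
qed

text \<open>Exchange \<open>T \<subseteq> x\<close> for \<open>S\<close> disjoint from \<open>x\<close> and let \<open>z\<close> be the result. If \<open>z\<close> avoids \<open>A\<close> then
  adding \<open>T\<close> to \<open>z\<close> leaves the avoiding family, and otherwise adding \<open>S\<close> to \<open>x - T\<close> does. The distance
  condition makes both assignments injective.\<close>

lemma card_level_le_crossings: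
  fixes V :: "nat set"
  assumes V: "finite V" "A \<subseteq> Pow V" and anti: "antichain A" and code: "distance_code (2 * r + 1) A"
    and r: "r \<ge> 1" "r \<le> i"
  shows "card (level A i) * (i choose r) * (card V - i choose r)
       \<le> card (crossings V (avoiding V A) r i) + card (crossings V (avoiding V A) r (i - r))"
proof -
  define D where "D = avoiding V A"
  have DV: "D \<subseteq> Pow V"
    by (auto simp: D_def avoiding_def)
  have fin: "finite z" if "z \<subseteq> V" for z
    using that V(1) by (rule finite_subset)
  define E where "E = (SIGMA x:level A i. {T. T \<subseteq> x \<and> card T = r} \<times> {S. S \<subseteq> V - x \<and> card S = r})"
  have E: "x \<in> A" "x \<subseteq> V" "card x = i" "T \<subseteq> x" "S \<subseteq> V - x" "card T = r" "card S = r"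
      "finite x" "finite T" "finite S" if "(x, T, S) \<in> E" for x T S
    using that V fin[of x] fin[of T] fin[of S] unfolding E_def level_def by auto
  define E1 where "E1 = {(x, T, S). (x, T, S) \<in> E \<and> (x - T) \<union> S \<in> D}"
  define E2 where "E2 = {(x, T, S). (x, T, S) \<in> E \<and> (x - T) \<union> S \<notin> D}"
  have "card E = (\<Sum>x\<in>level A i. (i choose r) * (card V - i choose r))"
  proof -
    have "card ({T. T \<subseteq> x \<and> card T = r} \<times> {S. S \<subseteq> V - x \<and> card S = r})
        = (i choose r) * (card V - i choose r)" if "x \<in> level A i" for x
      using that V fin[of x]
      by (auto simp: card_cartesian_product n_subsets card_Diff_subset level_def)
    moreover have "finite ({T. T \<subseteq> x \<and> card T = r} \<times> {S. S \<subseteq> V - x \<and> card S = r})"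
      if "x \<in> level A i" for x
      using that V fin[of x] by (auto simp: level_def)
    ultimately show ?thesis
      unfolding E_def using V by (subst card_SigmaI) auto
  qed
  then have cardE: "card E = card (level A i) * (i choose r) * (card V - i choose r)"
    by simp
  have "E = E1 \<union> E2"
    by (auto simp: E1_def E2_def)
  then have "card E \<le> card E1 + card E2"
    using card_Un_le by auto
  moreover have "card E1 \<le> card (crossings V D r i)"
  proof (rule card_inj_on_le)
    show "inj_on (\<lambda>(x, T, S). ((x - T) \<union> S, T)) E1"
    proof (rule inj_onI)
      fix p p' assume p: "p \<in> E1" "p' \<in> E1"
        and eq: "(case p of (x, T, S) \<Rightarrow> (x - T \<union> S, T)) = (case p' of (x, T, S) \<Rightarrow> (x - T \<union> S, T))"
      obtain x T S x' S' where pp': "p = (x, T, S)" "p' = (x', T, S')"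
        using eq by (cases p; cases p') auto
      have *: "x - T \<union> S = x' - T \<union> S'"
        using eq by (simp add: pp')
      from p pp' have e: "(x, T, S) \<in> E" "(x', T, S') \<in> E"
        by (auto simp: E1_def)
      \<comment> \<open>Both exchanges remove the same \<open>T\<close>, which lies in
        \<open>x\<close> and in \<open>x'\<close>, so the two sets can differ only in the inserted
        points.\<close>
      have "sym_diff x x' \<subseteq> S \<union> S'"
        using E(4,5)[OF e(1)] E(4,5)[OF e(2)] * by blast
      from code_eqI[OF code _ _ this] have "x = x'"
        using E[OF e(1)] E[OF e(2)] by simp
      moreover from this have "S = S'"
        using E(4,5)[OF e(1)] E(4,5)[OF e(2)] * by blast
      ultimately show "p = p'" by (simp add: pp')
    qed
    show "(\<lambda>(x, T, S). ((x - T) \<union> S, T)) ` E1 \<subseteq> crossings V D r i"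
    proof clarify
      fix x T S assume *: "(x, T, S) \<in> E1"
      then have e: "(x, T, S) \<in> E" and D: "(x - T) \<union> S \<in> D"
        by (auto simp: E1_def)
      note E = E[OF e]
      have "card ((x - T) \<union> S) = card (x - T) + card S"
        using E by (intro card_Un_disjoint) auto
      also have "\<dots> = i"
        using E r by (simp add: card_Diff_subset)
      finally have "card ((x - T) \<union> S) = i" .
      \<comment> \<open>Putting \<open>T\<close> back gives a superset of the member
        \<open>x\<close>.\<close>
      moreover have "(x - T) \<union> S \<union> T \<notin> D"
        using E by (auto simp: D_def avoiding_def)
      ultimately show "((x - T) \<union> S, T) \<in> crossings V D r i"
        using E D by (auto simp: crossings_def level_def)
    qed
  qed (use finite_crossings V DV in auto)
  moreover have "card E2 \<le> card (crossings V D r (i - r))"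
  proof (rule card_inj_on_le)
    show "inj_on (\<lambda>(x, T, S). (x - T, S)) E2"
    proof (rule inj_onI)
      fix p p' assume p: "p \<in> E2" "p' \<in> E2"
        and eq: "(case p of (x, T, S) \<Rightarrow> (x - T, S)) = (case p' of (x, T, S) \<Rightarrow> (x - T, S))"
      obtain x T S x' T' where pp': "p = (x, T, S)" "p' = (x', T', S)"
        using eq by (cases p; cases p') auto
      have *: "x - T = x' - T'"
        using eq by (simp add: pp')
      from p pp' have e: "(x, T, S) \<in> E" "(x', T', S) \<in> E"
        by (auto simp: E2_def)
      have "sym_diff x x' \<subseteq> T \<union> T'"
        using * by blast
      from code_eqI[OF code _ _ this] have "x = x'"
        using E[OF e(1)] E[OF e(2)] by simp
      moreover from this have "T = T'"
        using E(4)[OF e(1)] E(4)[OF e(2)] * by blast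
      ultimately show "p = p'" by (simp add: pp')
    qed
    show "(\<lambda>(x, T, S). (x - T, S)) ` E2 \<subseteq> crossings V D r (i - r)"
    proof clarify
      fix x T S assume *: "(x, T, S) \<in> E2"
      then have e: "(x, T, S) \<in> E" and D: "(x - T) \<union> S \<notin> D"
        by (auto simp: E2_def)
      note E = E[OF e]
      \<comment> \<open>Since \<open>r \<ge> 1\<close>, \<open>x - T\<close> is a proper subset of
        \<open>x\<close>; a member of \<open>A\<close> inside it would violate the antichain
        property.\<close>
      have "T \<noteq> {}" using E r by auto
      then have "x - T \<subset> x" using E by auto
      then have "\<not> a \<subseteq> x - T" if "a \<in> A" for a
        using anti that E(1) unfolding antichain_def by blast
      then have "x - T \<in> D"
        using E by (auto simp: D_def avoiding_def)
      then show "(x - T, S) \<in> crossings V D r (i - r)"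
        using E D by (auto simp: crossings_def level_def card_Diff_subset)
    qed
  qed (use finite_crossings V DV in auto)
  ultimately show ?thesis
    using cardE by (simp add: D_def)
qed

section \<open>Summing the layer bounds\<close>

text \<open>Raising the shift from \<open>q\<close> to \<open>Suc q\<close> adds
  \<open>f q - f (k + q)\<close> to the sum, which is at most 1.\<close>

lemma sum_shift_diff_le:
  fixes f :: "nat \<Rightarrow> real"
  assumes "\<And>j. 0 \<le> f j" "\<And>j. f j \<le> 1"
  shows "(\<Sum>j<k. f j - f (j + q)) \<le> real q"
proof (induction q)
  case (Suc q)
  have "(\<Sum>j<k. f j - f (j + Suc q)) = (\<Sum>j<k. f j - f (j + q)) - (\<Sum>j<k. f (Suc j + q) - f (j + q))"
    by (simp add: sum_subtractf)
  also have "(\<Sum>j<k. f (Suc j + q) - f (j + q)) = f (k + q) - f q"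
    using sum_lessThan_telescope[of "\<lambda>j. f (j + q)" k] by simp
  finally show ?case
    using Suc assms(1)[of "k + q"] assms(2)[of q] by simp
qed simp

lemma card_antichain_code_le:
  fixes V :: "nat set" and M :: real
  assumes V: "finite V" "A \<subseteq> Pow V" and anti: "antichain A" and code: "distance_code (2 * r + 1) A"
    and r: "r \<ge> 1" "2 * r \<le> card V" and size: "\<And>x. x \<in> A \<Longrightarrow> r \<le> card x \<and> card x + r \<le> card V"
    and M: "\<And>i. r \<le> i \<Longrightarrow> i \<le> card V \<Longrightarrow> real (card V choose i) \<le> M * real (i choose r)"
  shows "real (card A) \<le> 2 * real r * M"
proof -
  define m where "m = card V"
  have rm: "2 * r \<le> m"
    using r by (simp add: m_def)
  define D where "D = avoiding V A"
  have DV: "D \<subseteq> Pow V"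
    by (auto simp: D_def avoiding_def)
  have down: "y \<in> D" if "z \<in> D" "y \<subseteq> z" for y z
    using that unfolding D_def avoiding_def by blast
  define d where "d = density V D"
  have cr: "real (card (crossings V D r i)) = real (m choose i) * real (m - i choose r) * (d i - d (i + r))"
    if "i + r \<le> m" for i
    using card_crossings_density[OF V(1) DV down] that by (simp add: m_def d_def)
  \<comment> \<open>The difference is a number of exits divided by a positive factor.\<close>
  have mono: "d (i + r) \<le> d i" if "i + r \<le> m" for i
  proof -
    have "0 \<le> real (m choose i) * real (m - i choose r) * (d i - d (i + r))"
      using cr[OF that] by (metis of_nat_0_le_iff)
    moreover have "0 < real (m choose i) * real (m - i choose r)"
      using that by simp
    ultimately show ?thesis
      by (simp add: zero_le_mult_iff)
  qed
  have lev: "real (card (level A i)) \<le> M * (d (i - r) - d (i + r))" if i: "r \<le> i" "i + r \<le> m" for i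
  proof -
    define p where "p = real (i choose r)"
    define q where "q = real (m - i choose r)"
    define N where "N = real (m choose i)"
    have pos: "p > 0" "q > 0" "N > 0"
      using i by (auto simp: p_def q_def N_def)
    have Np: "N \<le> M * p"
      using M[of i] i by (simp add: N_def p_def m_def)
    \<comment> \<open>The bound \<open>M\<close> applied to the complementary layer
      \<open>m - i\<close>, so that \<open>M\<close> dominates both \<open>N / p\<close> and
      \<open>N / q\<close>.\<close>
    have Nq: "N \<le> M * q"
      using M[of "m - i"] i binomial_symmetric[of i m] by (simp add: N_def q_def m_def)
    \<comment> \<open>Expresses the exits from layer \<open>i - r\<close> through \<open>N\<close>
      as well. After division by \<open>p * q\<close> the two density drops have weights
      \<open>N / p\<close> and \<open>N / q\<close>; replacing both by \<open>M\<close> cancels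
      \<open>d i\<close>.\<close>
    have "(m choose (i - r)) * (m - (i - r) choose r) = (m choose i) * (i choose r)"
      using choose_mult[of "i - r" i m] i binomial_symmetric[of "i - r" i] by simp
    then have c2: "real (card (crossings V D r (i - r))) = N * p * (d (i - r) - d i)"
      using cr[of "i - r"] i unfolding N_def p_def by (simp flip: of_nat_mult)
    have c1: "real (card (crossings V D r i)) = N * q * (d i - d (i + r))"
      using cr[of i] i by (simp add: N_def q_def)
    have "real (card (level A i)) * p * q \<le> N * q * (d i - d (i + r)) + N * p * (d (i - r) - d i)"
      using card_level_le_crossings[OF V anti code r(1) i(1), folded D_def m_def, THEN of_nat_mono[where 'a = real]]
      unfolding of_nat_mult of_nat_add c1 c2 p_def[symmetric] q_def[symmetric] .
    also have "\<dots> \<le> (M * p) * q * (d i - d (i + r)) + (M * q) * p * (d (i - r) - d i)"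
      using Np Nq pos mono[of i] mono[of "i - r"] i
      by (intro add_mono mult_right_mono) auto
    also have "\<dots> = M * (d (i - r) - d (i + r)) * p * q"
      by (simp add: algebra_simps)
    finally show ?thesis
      using pos by simp
  qed
  have M0: "0 \<le> M"
    using M[of r] rm by (simp add: m_def)
  \<comment> \<open>The number of layers from \<open>r\<close> to \<open>m - r\<close>; with
    \<open>i = j + r\<close> the layer bound becomes a difference with shift
    \<open>2 * r\<close>.\<close>
  define k where "k = m - 2 * r + 1"
  have "A = (\<Union>j<k. level A (j + r))"
  proof
    show "A \<subseteq> (\<Union>j<k. level A (j + r))"
    proof
      fix x assume "x \<in> A"
      with size[of x] have "card x - r < k" "card x = card x - r + r"
        using rm by (auto simp: k_def m_def)
      with \<open>x \<in> A\<close> show "x \<in> (\<Union>j<k. level A (j + r))"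
        by (auto simp: level_def)
    qed
  qed (auto simp: level_def)
  then have "card A \<le> (\<Sum>j<k. card (level A (j + r)))"
    using card_UN_le[of "{..<k}" "\<lambda>j. level A (j + r)"] by simp
  then have "real (card A) \<le> (\<Sum>j<k. real (card (level A (j + r))))"
    by (simp flip: of_nat_sum)
  also have "\<dots> \<le> (\<Sum>j<k. M * (d j - d (j + 2 * r)))"
  proof (rule sum_mono)
    fix j assume "j \<in> {..<k}"
    then show "real (card (level A (j + r))) \<le> M * (d j - d (j + 2 * r))"
      using lev[of "j + r"] rm by (simp add: k_def mult_2 add.assoc)
  qed
  also have "\<dots> = M * (\<Sum>j<k. d j - d (j + 2 * r))"
    by (simp add: sum_distrib_left)
  also have "\<dots> \<le> M * real (2 * r)"
    using M0 density_nonneg density_le_1[OF V(1) DV] unfolding d_def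
    by (intro mult_left_mono sum_shift_diff_le) auto
  finally show ?thesis by (simp add: mult_ac)
qed

section \<open>Estimates for binomial coefficients\<close>

text \<open>The factor \<open>2 * n + 1\<close> lets the induction close: the step multiplies the
  left side by \<open>4 * (2 * n + 1) * (2 * n + 3) / (n + 1)\<^sup>2\<close>, which is at most
  16.\<close>

lemma central_binomial_square_le: "(2 * n choose n)\<^sup>2 * (2 * n + 1) \<le> 16 ^ n"
proof (induction n)
  case (Suc n)
  have eq: "(n + 1) * (2 * Suc n choose Suc n) = 2 * (2 * n + 1) * (2 * n choose n)"
  proof -
    have "2 * Suc n choose Suc n = 2 * (2 * n + 1 choose Suc n)"
      using binomial_symmetric[of n "2 * n + 1"] by simp
    moreover have "(2 * n + 1) * (2 * n choose n) = (2 * n + 1 choose Suc n) * Suc n"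
      using Suc_times_binomial_eq[of "2 * n" n] by simp
    ultimately show ?thesis
      by (metis Suc_eq_plus1 mult.assoc mult.commute)
  qed
  have "(n + 1)\<^sup>2 * ((2 * Suc n choose Suc n)\<^sup>2 * (2 * Suc n + 1))
      = ((n + 1) * (2 * Suc n choose Suc n))\<^sup>2 * (2 * n + 3)"
    by (simp add: power2_eq_square algebra_simps)
  also have "\<dots> = (2 * n choose n)\<^sup>2 * (2 * n + 1) * (4 * ((2 * n + 1) * (2 * n + 3)))"
    unfolding eq by (simp add: power2_eq_square algebra_simps)
  also have "\<dots> \<le> 16 ^ n * (4 * (4 * (n + 1)\<^sup>2))"
    by (rule mult_mono[OF Suc]) (auto simp: power2_eq_square algebra_simps)
  finally show ?case by (simp add: mult_ac)
qed simp

text \<open>Compare with the central coefficient. For odd \<open>m\<close>, twice the middle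
  coefficient is the central one of row \<open>m + 1\<close>.\<close>

lemma binomial_le_two_power_div_sqrt:
  assumes "m \<ge> 1"
  shows "real (m choose k) \<le> 2 ^ m / sqrt (real m)"
proof -
  have "(m choose k)\<^sup>2 * m \<le> 4 ^ m"
  proof (cases "even m")
    case True
    then obtain j where j: "m = 2 * j" by auto
    have "(m choose k)\<^sup>2 * m \<le> (2 * j choose j)\<^sup>2 * (2 * j + 1)"
      using binomial_maximum'[of j k] j by (intro mult_mono power_mono) auto
    also have "\<dots> \<le> 4 ^ m"
      using central_binomial_square_le[of j] by (simp add: j power_mult)
    finally show ?thesis .
  next
    case False
    then obtain j where j: "m = 2 * j + 1" by (auto elim: oddE)
    have "2 * (m choose k) \<le> 2 * (m choose j)"
      using binomial_maximum[of m k] by (simp add: j)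
    also have "\<dots> = 2 * Suc j choose Suc j"
      using binomial_symmetric[of j m] by (simp add: j)
    finally have "(2 * (m choose k))\<^sup>2 * m \<le> (2 * Suc j choose Suc j)\<^sup>2 * (2 * Suc j + 1)"
      using j by (intro mult_mono power_mono) auto
    also have "\<dots> \<le> 16 ^ Suc j"
      by (rule central_binomial_square_le)
    also have "\<dots> = 4 * 4 ^ m"
      by (simp add: j power_mult)
    finally show ?thesis by (simp add: power_mult_distrib)
  qed
  then have "(real (m choose k))\<^sup>2 * real m \<le> 4 ^ m"
    by (metis of_nat_le_iff of_nat_mult of_nat_numeral of_nat_power)
  moreover have "(2 ^ m)\<^sup>2 = (4 :: real) ^ m"
    by (simp add: power2_eq_square flip: power_mult_distrib)
  ultimately have "(real (m choose k) * sqrt (real m))\<^sup>2 \<le> (2 ^ m)\<^sup>2"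
    by (simp add: power_mult_distrib)
  then have "real (m choose k) * sqrt (real m) \<le> 2 ^ m"
    by (rule power2_le_imp_le) simp
  then show ?thesis
    using assms by (simp add: pos_le_divide_eq)
qed

text \<open>Passing to row \<open>m + r\<close> gives \<open>m choose i\<close> as
  \<open>(m + r choose (i + r)) * (i + r choose r) / (m + r choose r)\<close>. The first factor
  saves \<open>sqrt m\<close>, the denominator saves \<open>m ^ r\<close> up to a constant, and
  \<open>i + r choose r\<close> is within \<open>(2 * r) ^ r\<close> of \<open>i choose r\<close>
  because \<open>r \<le> i\<close>.\<close>

lemma binomial_le_mult_binomial:
  assumes r: "1 \<le> r" "r \<le> i" and i: "i \<le> m"
  shows "real (m choose i) \<le> (2 * (real r)\<^sup>2) ^ r * 2 ^ (m + r) / (real m ^ r * sqrt (real m)) * real (i choose r)"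
proof -
  have m: "m \<ge> 1" using assms by simp
  have "(m + r choose (i + r)) * (i + r choose r) = (m + r choose r) * (m choose i)"
    using choose_mult[of r "i + r" "m + r"] i by simp
  then have eq: "real (m + r choose r) * real (m choose i) = real (m + r choose (i + r)) * real (i + r choose r)"
    by (simp flip: of_nat_mult)
  have "(real m / real r) ^ r \<le> (real (m + r) / real r) ^ r"
    by (intro power_mono divide_right_mono) auto
  also have "\<dots> \<le> real (m + r choose r)"
    by (rule binomial_ge_n_over_k_pow_k) simp
  finally have "(real m / real r) ^ r * real (m choose i) \<le> real (m + r choose (i + r)) * real (i + r choose r)"
    unfolding eq[symmetric] by (intro mult_right_mono) auto
  also have "\<dots> \<le> (2 ^ (m + r) / sqrt (real m)) * ((2 * real r) ^ r * real (i choose r))"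
  proof (rule mult_mono)
    have "real (m + r choose (i + r)) \<le> 2 ^ (m + r) / sqrt (real (m + r))"
      using m by (intro binomial_le_two_power_div_sqrt) auto
    also have "\<dots> \<le> 2 ^ (m + r) / sqrt (real m)"
      using m by (intro divide_left_mono) auto
    finally show "real (m + r choose (i + r)) \<le> 2 ^ (m + r) / sqrt (real m)" .
    have "i + r choose r \<le> (i + r) ^ r"
      by (rule binomial_le_pow) simp
    also have "\<dots> \<le> (2 * i) ^ r"
      using r by (intro power_mono) auto
    finally have "real (i + r choose r) \<le> real ((2 * i) ^ r)"
      by (simp only: of_nat_le_iff)
    also have "\<dots> = (2 * real r * (real i / real r)) ^ r"
      using r by simp
    also have "\<dots> = (2 * real r) ^ r * (real i / real r) ^ r"
      by (rule power_mult_distrib)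
    also have "\<dots> \<le> (2 * real r) ^ r * real (i choose r)"
      using r by (intro mult_left_mono binomial_ge_n_over_k_pow_k) auto
    finally show "real (i + r choose r) \<le> (2 * real r) ^ r * real (i choose r)" .
  qed auto
  finally have "real (m choose i)
      \<le> (2 ^ (m + r) / sqrt (real m)) * ((2 * real r) ^ r * real (i choose r)) / (real m / real r) ^ r"
    using r m by (subst pos_le_divide_eq) (auto simp: mult.commute)
  also have "\<dots> = (2 * real r * real r) ^ r * 2 ^ (m + r) / (real m ^ r * sqrt (real m)) * real (i choose r)"
    by (simp add: power_mult_distrib power_divide mult_ac)
  finally show ?thesis
    by (simp only: power2_eq_square mult.assoc)
qed

section \<open>Padding the ground set and choosing the constant\<close>

theorem theorem1:
  fixes r :: nat
  assumes "r \<ge> 1"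
  shows "\<exists>C::real. C > 0 \<and> (\<forall>n::nat. \<forall>A. n \<ge> 1 \<longrightarrow> A \<subseteq> Pow {1..n} \<longrightarrow>
           antichain A \<longrightarrow> distance_code (2*r+1) A \<longrightarrow>
           real (card A) \<le> C * 2 ^ n * real n powr (- (real r + 1/2)))"
proof (intro exI conjI allI impI)
  \<comment> \<open>The factor \<open>2 * r\<close> comes from telescoping, the power of
    \<open>2 * r\<^sup>2\<close> from the binomial estimate, and \<open>3 * r\<close> from
    \<open>m + r = n + 3 * r\<close>.\<close>
  define C where "C = 2 * real r * ((2 * (real r)\<^sup>2) ^ r * 2 ^ (3 * r))"
  show "C > 0"
    using assms by (simp add: C_def)
  fix n :: nat and A
  assume n: "n \<ge> 1" and A: "A \<subseteq> Pow {1..n}" and anti: "antichain A" and code: "distance_code (2*r+1) A"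
  \<comment> \<open>Adding \<open>r\<close> new points to every member and \<open>r\<close> more to the ground set keeps all sizes away from
     the layers \<open>i < r\<close> and \<open>i > card V - r\<close>, where an \<open>r\<close>-element exchange is impossible.\<close>
  define V where "V = {1..n + 2 * r}"
  define P where "P = {n + 1..n + r}"
  define m where "m = n + 2 * r"
  have m: "card V = m" "m \<ge> 1" "m \<ge> n"
    using n by (auto simp: V_def m_def)
  have disj: "x \<inter> P = {}" "x \<subseteq> V" "card x \<le> n" "finite x" if "x \<in> A" for x
  proof -
    have x: "x \<subseteq> {1..n}" using that A by auto
    then show "card x \<le> n" "finite x"
      using card_mono[OF _ x] finite_subset[OF x] by auto
    show "x \<inter> P = {}" "x \<subseteq> V"
      using x by (auto simp: P_def V_def)
  qed
  define B where "B = (\<lambda>x. x \<union> P) ` A"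
  \<comment> \<open>All members are disjoint from \<open>P\<close>, so padding preserves
    distinctness, inclusions and symmetric differences.\<close>
  have inj: "inj_on (\<lambda>x. x \<union> P) A"
    using disj(1) by (intro inj_onI) blast
  have sub: "x \<subseteq> y" if "x \<in> A" "x \<union> P \<subseteq> y \<union> P" for x y
    using disj(1)[OF that(1)] that(2) by blast
  have sd: "sym_diff (x \<union> P) (y \<union> P) = sym_diff x y" if "x \<in> A" "y \<in> A" for x y
    using disj(1)[OF that(1)] disj(1)[OF that(2)] by blast
  define M where "M = (2 * (real r)\<^sup>2) ^ r * 2 ^ (m + r) / (real m ^ r * sqrt (real m))"
  have "real (card B) \<le> 2 * real r * M"
  proof (rule card_antichain_code_le[of V])
    show "B \<subseteq> Pow V"
      using disj(2) by (auto simp: B_def P_def V_def)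
    show "antichain B"
      using anti sub unfolding antichain_def B_def by blast
    show "distance_code (2 * r + 1) B"
      using code sd unfolding distance_code_def B_def by auto
    show "r \<le> card x \<and> card x + r \<le> card V" if "x \<in> B" for x
    proof -
      from that obtain y where y: "y \<in> A" "x = y \<union> P" by (auto simp: B_def)
      then have "card x = card y + r"
        using disj[OF y(1)] by (simp add: card_Un_disjoint P_def)
      then show ?thesis
        using disj(3)[OF y(1)] m by (simp add: m_def)
    qed
    show "real (card V choose i) \<le> M * real (i choose r)" if "r \<le> i" "i \<le> card V" for i
      using binomial_le_mult_binomial[OF assms that] by (simp add: M_def m)
  qed (use assms in \<open>auto simp: V_def\<close>)
  \<comment> \<open>Since \<open>m \<ge> n\<close>, the denominator may be shrunk from
    \<open>m\<close> to \<open>n\<close>.\<close>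
  also have "\<dots> \<le> 2 * real r * ((2 * (real r)\<^sup>2) ^ r * 2 ^ (m + r) / (real n ^ r * sqrt (real n)))"
    unfolding M_def using n m by (intro mult_left_mono divide_left_mono mult_mono power_mono) auto
  also have "real n ^ r * sqrt (real n) = real n powr (real r + 1/2)"
    using n by (simp add: powr_add powr_realpow powr_half_sqrt)
  also have "(2::real) ^ (m + r) = 2 ^ n * 2 ^ (3 * r)"
    by (simp add: m_def flip: power_add)
  also have "2 * real r * ((2 * (real r)\<^sup>2) ^ r * (2 ^ n * 2 ^ (3 * r)) / real n powr (real r + 1/2))
      = C * 2 ^ n * real n powr (- (real r + 1/2))"
    unfolding C_def powr_minus by (simp only: divide_inverse mult_ac)
  finally have "real (card B) \<le> C * 2 ^ n * real n powr (- (real r + 1/2))"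
    .
  moreover have "card B = card A"
    unfolding B_def using inj by (rule card_image)
  ultimately show "real (card A) \<le> C * 2 ^ n * real n powr (- (real r + 1/2))"
    by simp
qed

end
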